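(* Let $\mathbf{A}$ be an algebra; all relations below are binary relations on $\mathbf{A}$. Each of the following conditions implies all the conditions below it: (i) $R \subseteq [R, R|1]$ for every reflexive compatible relation $R$. (ia) $R^* \subseteq [R, R|1]$ for every reflexive compatible relation $R$. (ii) $R \cap T \subseteq [R, T|1]$ for all reflexive compatible relations $T, R$. (iii) $(R_1 \circ R_2)\cap T \subseteq \big(T \cap (R_2^- \circ (T \cap (R_1^- \circ R_1)) \circ R_2)\big)^*$ for all reflexive compatible relations $R_1$, $R_2$, $T$. (iv) $R_1 \cap (T \circ R_2) \subseteq \big(T \cap (R_2 \circ (T \cap (R_1^- \circ R_1)) \circ R_2^-)\big)^* \circ R_2$ for all reflexive compatible relations $R_1$, $R_2$, $T$. (v) $\beta \cap (T \circ S) \subseteq \big(T \cap (S \circ (T \cap \beta) \circ S)\big)^* \circ S$ for every congruence $\beta$, every tolerance $S$ and every reflexive compatible relation $T$. (vi) $\beta \cap (T \circ \gamma) \subseteq (\gamma \circ (T \cap \beta))^*$ for all congruences $\beta, \gamma$ and every reflexive compatible relation $T$. Moreover, conditions (i), (ia) and (ii) are equivalent for every algebra $\mathbf{A}$.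
   Context: A binary relation on an algebra $\mathbf{A}$ (with base set $A$) is called compatible (or admissible) if it is preserved by all operations of $\mathbf{A}$ applied coordinatewise. A tolerance is a reflexive, symmetric, compatible relation. For binary relations $R,S$ on $A$: $a\,(R\circ S)\,c$ iff there is $b\in A$ with $a\,R\,b\,S\,c$; $R^-$ is the converse of $R$; $R^*$ is the transitive closure of $R$. For compatible and reflexive relations $R,S$ on $\mathbf{A}$, $M(R,S)$ is the set of all matrices of the form $$\begin{vmatrix} t(\overline{a},\overline{b}) & t(\overline{a},\overline{b}\,') \\ t(\overline{a}\,',\overline{b}) & t(\overline{a}\,',\overline{b}\,')\end{vmatrix}$$ where $\overline{a},\overline{a}\,'\in A^n$, $\overline{b},\overline{b}\,'\in A^m$ for some $m,n\ge 0$, $t$ is an $(m+n)$-ary term operation of $\mathbf{A}$, and $\overline{a}\,R\,\overline{a}\,'$, $\overline{b}\,S\,\overline{b}\,'$ (componentwise). The commutator $[R,S|1]$ is the transitive closure of the set $$\left\{(z,w) \;\middle|\; \begin{vmatrix} x & x\\ z & w\end{vmatrix}\in M(R,S) \text{ for some } x\in A\right\}.$$ *)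

theory Defs
  imports Main
begin

text \<open>Only the symbols in \<open>ops\<close> belong to the signature, so that algebras without any basic
  operation are covered although every type is nonempty.\<close>

record ('f, 'a) alg =
  base :: "'a set"
  ops :: "'f set"
  arity :: "'f \<Rightarrow> nat"
  interp :: "'f \<Rightarrow> 'a list \<Rightarrow> 'a"

definition is_algebra :: "('f, 'a) alg \<Rightarrow> bool" where
  "is_algebra \<A> \<longleftrightarrow>
    (\<forall>f\<in>ops \<A>. \<forall>xs\<in>lists (base \<A>). length xs = arity \<A> f \<longrightarrow> interp \<A> f xs \<in> base \<A>)"

datatype 'f trm = Var nat | App 'f "'f trm list"

inductive is_term :: "('f, 'a) alg \<Rightarrow> nat \<Rightarrow> 'f trm \<Rightarrow> bool" for \<A> n where
  "i < n \<Longrightarrow> is_term \<A> n (Var i)"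
| "f \<in> ops \<A> \<Longrightarrow> length ts = arity \<A> f \<Longrightarrow> \<forall>t\<in>set ts. is_term \<A> n t \<Longrightarrow> is_term \<A> n (App f ts)"

primrec term_op :: "('f, 'a) alg \<Rightarrow> 'f trm \<Rightarrow> 'a list \<Rightarrow> 'a" where
  "term_op \<A> (Var i) xs = xs ! i"
| "term_op \<A> (App f ts) xs = interp \<A> f (map (\<lambda>t. term_op \<A> t xs) ts)"

definition compatible :: "('f, 'a) alg \<Rightarrow> 'a rel \<Rightarrow> bool" where
  "compatible \<A> R \<longleftrightarrow> R \<subseteq> base \<A> \<times> base \<A> \<and>
    (\<forall>f\<in>ops \<A>. \<forall>(xs, ys)\<in>listrel R.
       length xs = arity \<A> f \<longrightarrow> (interp \<A> f xs, interp \<A> f ys) \<in> R)"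

definition refl_compatible :: "('f, 'a) alg \<Rightarrow> 'a rel \<Rightarrow> bool" where
  "refl_compatible \<A> R \<longleftrightarrow> refl_on (base \<A>) R \<and> compatible \<A> R"

definition tolerance :: "('f, 'a) alg \<Rightarrow> 'a rel \<Rightarrow> bool" where
  "tolerance \<A> R \<longleftrightarrow> refl_on (base \<A>) R \<and> sym R \<and> compatible \<A> R"

definition congruence :: "('f, 'a) alg \<Rightarrow> 'a rel \<Rightarrow> bool" where
  "congruence \<A> R \<longleftrightarrow> equiv (base \<A>) R \<and> compatible \<A> R"

text \<open>A matrix is represented by the pair of its rows.\<close>

definition matrices ::
  "('f, 'a) alg \<Rightarrow> 'a rel \<Rightarrow> 'a rel \<Rightarrow> (('a \<times> 'a) \<times> ('a \<times> 'a)) set" where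
  "matrices \<A> R S =
    {((term_op \<A> t (a @ b), term_op \<A> t (a @ b')),
      (term_op \<A> t (a' @ b), term_op \<A> t (a' @ b'))) | t a a' b b'.
       a \<in> lists (base \<A>) \<and> a' \<in> lists (base \<A>) \<and> b \<in> lists (base \<A>) \<and> b' \<in> lists (base \<A>) \<and>
       is_term \<A> (length a + length b) t \<and> (a, a') \<in> listrel R \<and> (b, b') \<in> listrel S}"

definition commutator1 :: "('f, 'a) alg \<Rightarrow> 'a rel \<Rightarrow> 'a rel \<Rightarrow> 'a rel" where
  "commutator1 \<A> R S = {(z, w). \<exists>x\<in>base \<A>. ((x, x), (z, w)) \<in> matrices \<A> R S}\<^sup>+"

text \<open>The transitive closure of a relation is the non-reflexive closure \<open>trancl\<close> throughout:
  \<open>rtrancl\<close> would add pairs outside the base set.\<close>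

definition cond_i :: "('f, 'a) alg \<Rightarrow> bool" where
  "cond_i \<A> \<longleftrightarrow> (\<forall>R. refl_compatible \<A> R \<longrightarrow> R \<subseteq> commutator1 \<A> R R)"

definition cond_ia :: "('f, 'a) alg \<Rightarrow> bool" where
  "cond_ia \<A> \<longleftrightarrow> (\<forall>R. refl_compatible \<A> R \<longrightarrow> R\<^sup>+ \<subseteq> commutator1 \<A> R R)"

definition cond_ii :: "('f, 'a) alg \<Rightarrow> bool" where
  "cond_ii \<A> \<longleftrightarrow>
    (\<forall>R T. refl_compatible \<A> R \<and> refl_compatible \<A> T \<longrightarrow> R \<inter> T \<subseteq> commutator1 \<A> R T)"

definition cond_iii :: "('f, 'a) alg \<Rightarrow> bool" where
  "cond_iii \<A> \<longleftrightarrow>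
    (\<forall>R1 R2 T. refl_compatible \<A> R1 \<and> refl_compatible \<A> R2 \<and> refl_compatible \<A> T \<longrightarrow>
       (R1 O R2) \<inter> T \<subseteq> (T \<inter> (R2\<inverse> O (T \<inter> (R1\<inverse> O R1)) O R2))\<^sup>+)"

definition cond_iv :: "('f, 'a) alg \<Rightarrow> bool" where
  "cond_iv \<A> \<longleftrightarrow>
    (\<forall>R1 R2 T. refl_compatible \<A> R1 \<and> refl_compatible \<A> R2 \<and> refl_compatible \<A> T \<longrightarrow>
       R1 \<inter> (T O R2) \<subseteq> (T \<inter> (R2 O (T \<inter> (R1\<inverse> O R1)) O R2\<inverse>))\<^sup>+ O R2)"

definition cond_v :: "('f, 'a) alg \<Rightarrow> bool" where
  "cond_v \<A> \<longleftrightarrow>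
    (\<forall>\<beta> S T. congruence \<A> \<beta> \<and> tolerance \<A> S \<and> refl_compatible \<A> T \<longrightarrow>
       \<beta> \<inter> (T O S) \<subseteq> (T \<inter> (S O (T \<inter> \<beta>) O S))\<^sup>+ O S)"

definition cond_vi :: "('f, 'a) alg \<Rightarrow> bool" where
  "cond_vi \<A> \<longleftrightarrow>
    (\<forall>\<beta> \<gamma> T. congruence \<A> \<beta> \<and> congruence \<A> \<gamma> \<and> refl_compatible \<A> T \<longrightarrow>
       \<beta> \<inter> (T O \<gamma>) \<subseteq> (\<gamma> O (T \<inter> \<beta>))\<^sup>+)"

end

theory Submission
  imports Defs
begin

text \<open>The commutator is transitive by definition and monotone in both arguments. Transitivity
  lets (i) pass from \<open>R\<close> to its transitive closure; monotonicity gives (ii) from (i)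
  applied to \<open>R \<inter> T\<close>, while \<open>R = T\<close> in (ii) gives (i) back. The
  step with real content is (ii) to (iii), carried by \<open>matrices_relcomp_const_row\<close>.
  Apply (ii) to \<open>R1 O R2\<close> and \<open>T\<close>, and take a matrix with constant top
  row. Since its first argument tuples are related through an intermediate tuple, a middle row can
  be inserted: its two entries are \<open>T\<close>-related, both are \<open>R1\<close>-successors
  of the common top entry, and \<open>R2\<close> links them to the bottom row. So every generating
  pair of the commutator lies in the relation under the closure in (iii). The rest is relational
  calculus: (iv) is (iii) for the converse of \<open>R2\<close>, (v) is a special case of (iv), and
  (vi) follows from (v) by absorbing adjacent factors \<open>\<gamma>\<close>
  (\<open>trancl_relcomp_absorb\<close>).\<close>

lemma listrel_append:
  "(xs, ys) \<in> listrel R \<Longrightarrow> (us, vs) \<in> listrel R \<Longrightarrow> (xs @ us, ys @ vs) \<in> listrel R"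
  by (auto simp: listrel_iff_zip)

lemma listrel_relcompE:
  assumes "(xs, zs) \<in> listrel (R O S)"
  obtains ys where "(xs, ys) \<in> listrel R" "(ys, zs) \<in> listrel S"
  using assms
proof (induction arbitrary: thesis rule: listrel.induct)
  case Nil
  then show ?case by (blast intro: listrel.Nil)
next
  case (Cons x z xs zs)
  then show ?case by (blast intro: listrel.Cons)
qed

lemma compatibleD:
  "compatible \<A> R \<Longrightarrow> f \<in> ops \<A> \<Longrightarrow> length xs = arity \<A> f \<Longrightarrow> (xs, ys) \<in> listrel R \<Longrightarrow>
    (interp \<A> f xs, interp \<A> f ys) \<in> R"
  by (auto simp: compatible_def)

lemma compatible_term_op:
  assumes "compatible \<A> R" "is_term \<A> n t" "(xs, ys) \<in> listrel R" "length xs = n"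
  shows "(term_op \<A> t xs, term_op \<A> t ys) \<in> R"
  using assms(2)
proof induction
  case (1 i)
  then show ?case using assms by (simp add: listrel_iff_nth)
next
  case (2 f ts)
  then show ?case
    by (auto intro!: compatibleD[OF assms(1)] simp: listrel_iff_nth)
qed

lemma refl_compatibleI:
  assumes "R \<subseteq> base \<A> \<times> base \<A>" "\<And>x. x \<in> base \<A> \<Longrightarrow> (x, x) \<in> R"
    and "\<And>f xs ys. f \<in> ops \<A> \<Longrightarrow> length xs = arity \<A> f \<Longrightarrow> (xs, ys) \<in> listrel R \<Longrightarrow>
      (interp \<A> f xs, interp \<A> f ys) \<in> R"
  shows "refl_compatible \<A> R"
  using assms by (auto simp: refl_compatible_def compatible_def intro: refl_onI)

lemma refl_compatibleD:
  assumes "refl_compatible \<A> R"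
  shows "R \<subseteq> base \<A> \<times> base \<A>" "x \<in> base \<A> \<Longrightarrow> (x, x) \<in> R" "compatible \<A> R"
  using assms by (auto simp: refl_compatible_def compatible_def dest: refl_onD)

lemma refl_compatible_Int:
  assumes "refl_compatible \<A> R" "refl_compatible \<A> S"
  shows "refl_compatible \<A> (R \<inter> S)"
proof (rule refl_compatibleI)
  fix f xs ys
  assume *: "f \<in> ops \<A>" "length xs = arity \<A> f" "(xs, ys) \<in> listrel (R \<inter> S)"
  then have "(xs, ys) \<in> listrel R" "(xs, ys) \<in> listrel S"
    by (simp_all add: listrel_iff_nth)
  with * show "(interp \<A> f xs, interp \<A> f ys) \<in> R \<inter> S"
    using assms[THEN refl_compatibleD(3)] by (blast intro: compatibleD)
qed (use assms[THEN refl_compatibleD(1)] assms[THEN refl_compatibleD(2)] in auto)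

lemma refl_compatible_converse:
  assumes "refl_compatible \<A> R"
  shows "refl_compatible \<A> (R\<inverse>)"
proof (rule refl_compatibleI)
  fix f xs ys
  assume *: "f \<in> ops \<A>" "length xs = arity \<A> f" "(xs, ys) \<in> listrel (R\<inverse>)"
  then have "(ys, xs) \<in> listrel R" "length ys = arity \<A> f"
    by (simp_all add: listrel_iff_nth)
  with * show "(interp \<A> f xs, interp \<A> f ys) \<in> R\<inverse>"
    using assms[THEN refl_compatibleD(3)] by (blast intro: compatibleD)
qed (use assms[THEN refl_compatibleD(1)] assms[THEN refl_compatibleD(2)] in auto)

lemma refl_compatible_relcomp:
  assumes "refl_compatible \<A> R" "refl_compatible \<A> S"
  shows "refl_compatible \<A> (R O S)"
proof (rule refl_compatibleI)
  fix f xs zs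
  assume *: "f \<in> ops \<A>" "length xs = arity \<A> f" "(xs, zs) \<in> listrel (R O S)"
  obtain ys where ys: "(xs, ys) \<in> listrel R" "(ys, zs) \<in> listrel S"
    using *(3) by (rule listrel_relcompE)
  then have "length ys = arity \<A> f"
    using *(2) by (simp add: listrel_iff_nth)
  with * ys show "(interp \<A> f xs, interp \<A> f zs) \<in> R O S"
    using assms[THEN refl_compatibleD(3)] by (blast intro: compatibleD)
qed (use assms[THEN refl_compatibleD(1)] assms[THEN refl_compatibleD(2)] in blast)+

lemma congruence_refl_compatible: "congruence \<A> \<beta> \<Longrightarrow> refl_compatible \<A> \<beta>"
  by (simp add: congruence_def refl_compatible_def equiv_def)

lemma congruence_tolerance: "congruence \<A> \<beta> \<Longrightarrow> tolerance \<A> \<beta>"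
  by (simp add: congruence_def tolerance_def equiv_def)

lemma tolerance_refl_compatible: "tolerance \<A> S \<Longrightarrow> refl_compatible \<A> S"
  by (simp add: tolerance_def refl_compatible_def)

lemma matrices_mono:
  assumes "R \<subseteq> R'" "S \<subseteq> S'"
  shows "matrices \<A> R S \<subseteq> matrices \<A> R' S'"
  using listrel_mono[OF assms(1)] listrel_mono[OF assms(2)]
  unfolding matrices_def by blast

lemma commutator1_mono:
  assumes "R \<subseteq> R'" "S \<subseteq> S'"
  shows "commutator1 \<A> R S \<subseteq> commutator1 \<A> R' S'"
  unfolding commutator1_def
  using matrices_mono[OF assms, of \<A>] by (intro trancl_mono_subset) blast

text \<open>Compare \<open>t(a, b)\<close> and \<open>t(a, b')\<close>, both equal to \<open>x\<close>, with \<open>t(c, b)\<close> and \<open>t(c, b')\<close>,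
  where \<open>c\<close> is intermediate between \<open>a\<close> and \<open>a'\<close>.\<close>

lemma matrices_relcomp_const_row:
  assumes R1: "refl_compatible \<A> R1" and R2: "refl_compatible \<A> R2" and T: "refl_compatible \<A> T"
    and "((x, x), (z, w)) \<in> matrices \<A> (R1 O R2) T"
  shows "(z, w) \<in> T \<inter> (R2\<inverse> O (T \<inter> (R1\<inverse> O R1)) O R2)"
proof -
  obtain t a a' b b' where
    x: "x = term_op \<A> t (a @ b)" "x = term_op \<A> t (a @ b')" and
    z: "z = term_op \<A> t (a' @ b)" and w: "w = term_op \<A> t (a' @ b')" and
    lists: "a' \<in> lists (base \<A>)" "b \<in> lists (base \<A>)" "b' \<in> lists (base \<A>)" and
    t: "is_term \<A> (length a + length b) t" and
    aa': "(a, a') \<in> listrel (R1 O R2)" and bb': "(b, b') \<in> listrel T"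
    using assms(4) unfolding matrices_def by blast
  obtain c where ac: "(a, c) \<in> listrel R1" and ca': "(c, a') \<in> listrel R2"
    using aa' by (rule listrel_relcompE)
  have len: "length c = length a" "length a' = length a" "length b' = length b"
    using ac ca' bb' by (simp_all add: listrel_iff_nth)
  \<comment> \<open>\<open>T\<close> is reflexive only on the base set, and the middle row keeps
    \<open>c\<close> fixed while \<open>b\<close> moves to \<open>b'\<close>.\<close>
  have "c \<in> lists (base \<A>)"
    using ac R1 by (fastforce simp: refl_compatible_def compatible_def listrel_iff_nth in_set_conv_nth)
  have refl: "(us, us) \<in> listrel R" if "refl_compatible \<A> R" "us \<in> lists (base \<A>)" for us R
    using that unfolding refl_compatible_def by (blast intro: refl_onD[OF listrel_refl_on])
  have step: "(term_op \<A> t (us @ vs), term_op \<A> t (us' @ vs')) \<in> R"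
    if "refl_compatible \<A> R" "(us, us') \<in> listrel R" "(vs, vs') \<in> listrel R"
      "length us = length a" "length vs = length b" for R us us' vs vs'
    using that t unfolding refl_compatible_def
    by (intro compatible_term_op[OF _ t] listrel_append) auto
  have "(z, w) \<in> T"
    unfolding z w using T lists bb' len by (intro step refl) auto
  moreover have "(term_op \<A> t (c @ b), z) \<in> R2" "(term_op \<A> t (c @ b'), w) \<in> R2"
    unfolding z w using R2 lists ca' len by (auto intro!: step refl)
  moreover have "(term_op \<A> t (c @ b), term_op \<A> t (c @ b')) \<in> T"
    using T \<open>c \<in> lists (base \<A>)\<close> bb' len by (intro step refl) auto
  \<comment> \<open>Here the constant top row is used: \<open>x\<close> is read once as the value at
    \<open>b\<close> and once as the value at \<open>b'\<close>, so the middle entries share an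
    \<open>R1\<close>-predecessor.\<close>
  moreover have "(x, term_op \<A> t (c @ b)) \<in> R1"
    unfolding x(1) using R1 lists ac len by (intro step refl) auto
  moreover have "(x, term_op \<A> t (c @ b')) \<in> R1"
    unfolding x(2) using R1 lists ac len by (intro step refl) auto
  ultimately show ?thesis by blast
qed

lemma trancl_subset_commutator1:
  assumes "Q \<subseteq> commutator1 \<A> R S"
  shows "Q\<^sup>+ \<subseteq> commutator1 \<A> R S"
proof -
  have "Q\<^sup>+ \<subseteq> (commutator1 \<A> R S)\<^sup>+"
    using assms by (rule trancl_mono_subset)
  also have "\<dots> = commutator1 \<A> R S"
    by (simp add: commutator1_def)
  finally show ?thesis .
qed

lemma cond_i_iff_ia: "cond_i \<A> \<longleftrightarrow> cond_ia \<A>"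
  unfolding cond_i_def cond_ia_def
  by (auto intro: trancl_subset_commutator1[THEN subsetD])

text \<open>Condition (i) is applied to \<open>R \<inter> T\<close>, which is again reflexive and
  compatible; monotonicity then enlarges the two arguments separately.\<close>

lemma cond_i_imp_ii:
  assumes "cond_i \<A>"
  shows "cond_ii \<A>"
  unfolding cond_ii_def
proof (intro allI impI, elim conjE)
  fix R T
  assume "refl_compatible \<A> R" "refl_compatible \<A> T"
  then have "R \<inter> T \<subseteq> commutator1 \<A> (R \<inter> T) (R \<inter> T)"
    using assms refl_compatible_Int unfolding cond_i_def by blast
  also have "\<dots> \<subseteq> commutator1 \<A> R T"
    by (rule commutator1_mono) auto
  finally show "R \<inter> T \<subseteq> commutator1 \<A> R T" .
qed

lemma cond_ii_imp_i: "cond_ii \<A> \<Longrightarrow> cond_i \<A>"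
  unfolding cond_i_def cond_ii_def by (metis inf.idem)

lemma cond_ii_imp_iii:
  assumes "cond_ii \<A>"
  shows "cond_iii \<A>"
  unfolding cond_iii_def
proof (intro allI impI, elim conjE)
  fix R1 R2 T
  assume rc: "refl_compatible \<A> R1" "refl_compatible \<A> R2" "refl_compatible \<A> T"
  have "(R1 O R2) \<inter> T \<subseteq> commutator1 \<A> (R1 O R2) T"
    using assms rc refl_compatible_relcomp unfolding cond_ii_def by blast
  also have "\<dots> \<subseteq> (T \<inter> (R2\<inverse> O (T \<inter> (R1\<inverse> O R1)) O R2))\<^sup>+"
    unfolding commutator1_def using matrices_relcomp_const_row[OF rc]
    by (intro trancl_mono_subset) blast
  finally show "(R1 O R2) \<inter> T \<subseteq> (T \<inter> (R2\<inverse> O (T \<inter> (R1\<inverse> O R1)) O R2))\<^sup>+" .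
qed

lemma cond_iii_imp_iv:
  assumes "cond_iii \<A>"
  shows "cond_iv \<A>"
  unfolding cond_iv_def
proof (intro allI impI, elim conjE)
  fix R1 R2 T
  assume rc: "refl_compatible \<A> R1" "refl_compatible \<A> R2" "refl_compatible \<A> T"
  \<comment> \<open>If \<open>x\<close> is \<open>R1\<close>-related to \<open>z\<close>, and
    \<open>T\<close> followed by \<open>R2\<close> leads from \<open>x\<close> through
    \<open>y\<close> to \<open>z\<close>, then \<open>(x, y)\<close> lies in the left-hand side
    here. The remaining step from \<open>y\<close> to \<open>z\<close> is the trailing
    \<open>R2\<close> in (iv).\<close>
  have "(R1 O R2\<inverse>) \<inter> T \<subseteq> (T \<inter> (R2 O (T \<inter> (R1\<inverse> O R1)) O R2\<inverse>))\<^sup>+"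
    using assms rc refl_compatible_converse[OF rc(2)] unfolding cond_iii_def
    by (metis converse_converse)
  then show "R1 \<inter> (T O R2) \<subseteq> (T \<inter> (R2 O (T \<inter> (R1\<inverse> O R1)) O R2\<inverse>))\<^sup>+ O R2"
    by blast
qed

text \<open>Take \<open>R1 = \<beta>\<close> and \<open>R2 = S\<close>: symmetry and transitivity
  collapse \<open>\<beta>\<inverse> O \<beta>\<close> to \<open>\<beta>\<close>, and symmetry
  removes the converse from \<open>S\<close>.\<close>

lemma cond_iv_imp_v:
  assumes "cond_iv \<A>"
  shows "cond_v \<A>"
  unfolding cond_v_def
proof (intro allI impI, elim conjE)
  fix \<beta> S T
  assume \<beta>: "congruence \<A> \<beta>" and S: "tolerance \<A> S" and T: "refl_compatible \<A> T"
  have "\<beta>\<inverse> O \<beta> = \<beta>"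
    using \<beta> by (intro equiv_comp_eq[of "base \<A>"]) (simp add: congruence_def)
  moreover have "S\<inverse> = S"
    using S by (simp add: tolerance_def sym_conv_converse_eq)
  ultimately show "\<beta> \<inter> (T O S) \<subseteq> (T \<inter> (S O (T \<inter> \<beta>) O S))\<^sup>+ O S"
    using assms congruence_refl_compatible[OF \<beta>] tolerance_refl_compatible[OF S] T
    unfolding cond_iv_def by metis
qed

text \<open>In a chain of blocks \<open>G O D O G\<close>, the last \<open>G\<close> of one block
  and the first \<open>G\<close> of the next merge by transitivity, so only the final
  \<open>G\<close> survives separately.\<close>

lemma trancl_relcomp_absorb:
  assumes "trans G"
  shows "(G O D O G)\<^sup>+ O G \<subseteq> (G O D)\<^sup>+ O G"
proof -
  have "(x, z) \<in> (G O D)\<^sup>+ O G" if "(x, y) \<in> (G O D O G)\<^sup>+" "(y, z) \<in> G" for x y z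
    using that
  proof (induction arbitrary: z rule: trancl_induct)
    case (base y)
    then show ?case using assms by (blast dest: transD)
  next
    case (step y y')
    then obtain u v where "(y, u) \<in> G" "(u, v) \<in> D" "(v, z) \<in> G"
      using assms by (blast dest: transD)
    \<comment> \<open>The hypothesis is used at the endpoint \<open>u\<close>, not \<open>z\<close>:
      the first \<open>G\<close> of the new block serves as the trailing \<open>G\<close> of the
      earlier chain.\<close>
    moreover obtain s where "(x, s) \<in> (G O D)\<^sup>+" "(s, u) \<in> G"
      using step.IH[OF \<open>(y, u) \<in> G\<close>] by blast
    ultimately show ?case by (blast intro: trancl_into_trancl)
  qed
  then show ?thesis by blast
qed

lemma cond_v_imp_vi:
  assumes "cond_v \<A>"
  shows "cond_vi \<A>"
  unfolding cond_vi_def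
proof (intro allI impI, elim conjE)
  fix \<beta> \<gamma> T
  assume \<beta>: "congruence \<A> \<beta>" and \<gamma>: "congruence \<A> \<gamma>" and T: "refl_compatible \<A> T"
  let ?D = "T \<inter> \<beta>"
  have trans: "trans \<gamma>"
    using \<gamma> by (simp add: congruence_def equiv_def)
  have \<gamma>_le: "\<gamma> \<subseteq> \<gamma> O ?D"
  proof -
    \<comment> \<open>Reflexivity of \<open>?D\<close> pads a lone \<open>\<gamma>\<close> step to a
      full block \<open>\<gamma> O ?D\<close>; below this turns the trailing \<open>\<gamma>\<close>
      into one more link of the chain.\<close>
    have "(y, y) \<in> ?D" if "(x, y) \<in> \<gamma>" for x y
      using that \<gamma> refl_compatible_Int[OF T congruence_refl_compatible[OF \<beta>]]
      by (auto simp: congruence_def refl_compatible_def compatible_def refl_on_def)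
    then show ?thesis by (auto intro!: relcomp.relcompI)
  qed
  have "\<beta> \<inter> (T O \<gamma>) \<subseteq> (T \<inter> (\<gamma> O ?D O \<gamma>))\<^sup>+ O \<gamma>"
    using assms \<beta> congruence_tolerance[OF \<gamma>] T unfolding cond_v_def by blast
  also have "\<dots> \<subseteq> (\<gamma> O ?D O \<gamma>)\<^sup>+ O \<gamma>"
    by (intro relcomp_mono trancl_mono_subset) auto
  also have "\<dots> \<subseteq> (\<gamma> O ?D)\<^sup>+ O \<gamma>"
    by (rule trancl_relcomp_absorb[OF trans])
  also have "\<dots> \<subseteq> (\<gamma> O ?D)\<^sup>+ O (\<gamma> O ?D)"
    by (intro relcomp_mono \<gamma>_le order_refl)
  also have "\<dots> \<subseteq> (\<gamma> O ?D)\<^sup>+"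
    by (blast intro: trancl_into_trancl)
  finally show "\<beta> \<inter> (T O \<gamma>) \<subseteq> (\<gamma> O ?D)\<^sup>+" .
qed

theorem theorem3:
  fixes \<A> :: "('f, 'a) alg"
  assumes "is_algebra \<A>"
  shows "sorted_wrt (\<longrightarrow>)
           [cond_i \<A>, cond_ia \<A>, cond_ii \<A>, cond_iii \<A>, cond_iv \<A>, cond_v \<A>, cond_vi \<A>]
         \<and> (cond_i \<A> \<longleftrightarrow> cond_ia \<A>) \<and> (cond_ia \<A> \<longleftrightarrow> cond_ii \<A>)"
  using cond_i_iff_ia[of \<A>] cond_i_imp_ii[of \<A>] cond_ii_imp_i[of \<A>] cond_ii_imp_iii[of \<A>]
    cond_iii_imp_iv[of \<A>] cond_iv_imp_v[of \<A>] cond_v_imp_vi[of \<A>]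
  by auto

end
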